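(* Let $\mu_1,\mu_2$ be sub-distributions over countable sets $A_1,A_2$, let $\varepsilon,\delta$ be reals, let $P\subseteq A_1$, and let $R,S\subseteq A_1\times A_2$ be relations such that there are $(\varepsilon,\delta)$-approximate liftings of $R$ and of $S$ relating $\mu_1$ and $\mu_2$. Suppose $R(P)\cap S(A_1\setminus P)=\varnothing$, where for $R'\subseteq A_1\times A_2$ and $X\subseteq A_1$, $R'(X)=\{a_2\in A_2:\exists a_1\in X,\,(a_1,a_2)\in R'\}$. Then there is an $(\varepsilon,2\delta)$-approximate lifting relating $\mu_1$ and $\mu_2$ of the relation $T=\{(a_1,a_2): (a_1\in P\Rightarrow (a_1,a_2)\in R)\wedge(a_1\notin P\Rightarrow (a_1,a_2)\in S)\}$.
   Context: A sub-distribution over a countable set $A$ is $\mu:A\to[0,1]$ with $\sum_a\mu(a)\le1$; $\mu(X)=\sum_{a\in X}\mu(a)$; marginals of $\mu$ over $A_1\times A_2$ are $\pi_1(\mu)(a_1)=\sum_{a_2}\mu(a_1,a_2)$, $\pi_2(\mu)(a_2)=\sum_{a_1}\mu(a_1,a_2)$. $d_\varepsilon(\nu_1,\nu_2)=\max_{X}(\nu_1(X)-e^{\varepsilon}\nu_2(X))$. With a fresh element $\star$, $A^\star=A\cup\{\star\}$ and $Q^\star=Q\cup(A_1\times\{\star\})\cup(\{\star\}\times A_2)$ for $Q\subseteq A_1\times A_2$. An $(\varepsilon,\delta)$-approximate $Q$-lifting of $(\mu_1,\mu_2)$ exists if there are sub-distributions $\mu_L,\mu_R$ over $A_1^\star\times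 A_2^\star$ with $\pi_1(\mu_L)=\mu_1$, $\pi_2(\mu_R)=\mu_2$ (with $\mu_i(\star)=0$), $\mathrm{supp}(\mu_L)\cup\mathrm{supp}(\mu_R)\subseteq Q^\star$, and $d_\varepsilon(\mu_L,\mu_R)\le\delta$. *)

theory Defs
  imports "HOL-Probability.SPMF"
begin

text \<open>
  A sub-distribution over a countable set \<open>A\<close> is represented by a library
  sub-probability mass function \<open>\<mu> :: 'a spmf\<close> whose support \<open>set_spmf \<mu>\<close> lies in \<open>A\<close>;
  \<open>\<mu>(a)\<close> is \<open>spmf \<mu> a\<close>, \<open>\<mu>(X)\<close> is \<open>measure (measure_spmf \<mu>) X\<close>, and the marginals are
  \<open>map_spmf fst \<mu>\<close> and \<open>map_spmf snd \<mu>\<close>.  The lemmas below confirm that these agree with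
  the pointwise sums.
\<close>

definition subdist_on :: "'a set \<Rightarrow> 'a spmf \<Rightarrow> bool" where
  "subdist_on A \<mu> \<longleftrightarrow> set_spmf \<mu> \<subseteq> A"

lemma has_sum_measure_spmf: "(spmf \<mu> has_sum measure (measure_spmf \<mu>) X) X"
proof -
  have "(pmf \<mu> has_sum infsetsum (pmf \<mu>) (Some ` X)) (Some ` X)"
    unfolding infsetsum_infsum[OF pmf_abs_summable]
    using pmf_abs_summable[of \<mu> "Some ` X"]
    by (intro has_sum_infsum) (simp flip: abs_summable_equivalent)
  then have "((pmf \<mu> \<circ> Some) has_sum infsetsum (pmf \<mu>) (Some ` X)) X"
    by (subst (asm) has_sum_reindex) auto
  then show ?thesis
    by (simp add: o_def measure_measure_spmf_conv_measure_pmf measure_pmf_conv_infsetsum)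
qed

lemma has_sum_marginal_fst:
  "((\<lambda>b. spmf \<mu> (a, b)) has_sum spmf (map_spmf fst \<mu>) a) UNIV"
proof -
  have "fst -` {a} = range (Pair a)" by auto
  then have "(spmf \<mu> has_sum spmf (map_spmf fst \<mu>) a) (range (Pair a))"
    using has_sum_measure_spmf[of \<mu> "fst -` {a}"] by (metis spmf_map)
  then have "((spmf \<mu> \<circ> Pair a) has_sum spmf (map_spmf fst \<mu>) a) UNIV"
    by (subst (asm) has_sum_reindex) (auto simp: inj_on_def)
  then show ?thesis by (simp only: o_def)
qed

lemma has_sum_marginal_snd:
  "((\<lambda>a. spmf \<mu> (a, b)) has_sum spmf (map_spmf snd \<mu>) b) UNIV"
proof -
  have "snd -` {b} = range (\<lambda>a. (a, b))" by auto
  then have "(spmf \<mu> has_sum spmf (map_spmf snd \<mu>) b) (range (\<lambda>a. (a, b)))"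
    using has_sum_measure_spmf[of \<mu> "snd -` {b}"] by (metis spmf_map)
  then have "((spmf \<mu> \<circ> (\<lambda>a. (a, b))) has_sum spmf (map_spmf snd \<mu>) b) UNIV"
    by (subst (asm) has_sum_reindex) (auto simp: inj_on_def)
  then show ?thesis by (simp only: o_def)
qed

lemma subdist_on_exists:
  fixes f :: "'a \<Rightarrow> real"
  assumes "\<And>a. a \<in> A \<Longrightarrow> 0 \<le> f a" "f summable_on A" "infsum f A \<le> 1"
  shows "\<exists>\<mu>. subdist_on A \<mu> \<and> (\<forall>a\<in>A. spmf \<mu> a = f a)"
proof -
  define g where "g a = (if a \<in> A then f a else 0)" for a
  have nonneg: "0 \<le> g a" for a
    using assms(1) by (simp add: g_def)
  have "infsum g UNIV = infsum f A"
    by (rule infsum_cong_neutral) (auto simp: g_def)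
  moreover have "g summable_on UNIV"
    using assms(2) summable_on_cong_neutral[of UNIV A g f] by (auto simp: g_def)
  then have abs: "g abs_summable_on UNIV"
    using nonneg by (simp flip: abs_summable_equivalent)
  ultimately have "(\<integral>\<^sup>+ a. ennreal (g a) \<partial>count_space UNIV) \<le> 1"
    using assms(3) nn_integral_conv_infsetsum[OF abs nonneg] infsetsum_infsum[OF abs] by simp
  then have "spmf (embed_spmf g) a = g a" for a
    using nonneg by (simp add: spmf_embed_spmf)
  then show ?thesis
    by (intro exI[of _ "embed_spmf g"])
       (auto simp: subdist_on_def in_set_spmf_iff_spmf g_def split: if_splits)
qed

text \<open>
  The maximum of \<open>\<nu>\<^sub>1(X) - e\<^sup>\<epsilon> \<nu>\<^sub>2(X)\<close> over all events, written as a supremum; it is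
  attained by lemma \<open>eps_dist_attained\<close>.  Letting \<open>X\<close> range over all sets of the type rather than
  over subsets of the carrier makes no difference, as there is no mass outside the carrier.
\<close>

definition eps_dist :: "real \<Rightarrow> 'a spmf \<Rightarrow> 'a spmf \<Rightarrow> real" where
  "eps_dist \<epsilon> \<nu>\<^sub>1 \<nu>\<^sub>2 =
    (SUP X. measure (measure_spmf \<nu>\<^sub>1) X - exp \<epsilon> * measure (measure_spmf \<nu>\<^sub>2) X)"

lemma eps_dist_attained:
  obtains X where
    "eps_dist \<epsilon> \<nu>\<^sub>1 \<nu>\<^sub>2 = measure (measure_spmf \<nu>\<^sub>1) X - exp \<epsilon> * measure (measure_spmf \<nu>\<^sub>2) X"
    "\<And>Y. measure (measure_spmf \<nu>\<^sub>1) Y - exp \<epsilon> * measure (measure_spmf \<nu>\<^sub>2) Y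
        \<le> measure (measure_spmf \<nu>\<^sub>1) X - exp \<epsilon> * measure (measure_spmf \<nu>\<^sub>2) X"
proof -
  let ?g = "\<lambda>Y. measure (measure_spmf \<nu>\<^sub>1) Y - exp \<epsilon> * measure (measure_spmf \<nu>\<^sub>2) Y"
  let ?h = "\<lambda>a. spmf \<nu>\<^sub>1 a - exp \<epsilon> * spmf \<nu>\<^sub>2 a"
  let ?X = "{a. ?h a > 0}"
  have sum: "(?h has_sum ?g Y) Y" for Y
    using has_sum_add[OF has_sum_measure_spmf[of \<nu>\<^sub>1 Y]
        has_sum_cmult_right[OF has_sum_measure_spmf[of \<nu>\<^sub>2 Y], of "- exp \<epsilon>"]]
    by simp
  have max: "?g Y \<le> ?g ?X" for Y
    by (rule has_sum_mono_neutral[OF sum sum]) auto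
  have "eps_dist \<epsilon> \<nu>\<^sub>1 \<nu>\<^sub>2 = ?g ?X"
    unfolding eps_dist_def by (rule cSup_eq_maximum) (use max in auto)
  then show ?thesis
    using that max by blast
qed

text \<open>
  The fresh element \<open>\<star>\<close> is \<open>None\<close>, and \<open>a \<in> A\<close> is embedded as \<open>Some a\<close>.
  This is independent of the \<open>None\<close> used internally by \<^typ>\<open>'a spmf\<close> for the missing mass:
  an atom at \<open>\<star>\<close> of a sub-distribution over \<^typ>\<open>'a option\<close> counts as genuine mass.
\<close>

definition star :: "'a set \<Rightarrow> 'a option set" where
  "star A = insert None (Some ` A)"

definition star_rel :: "'a set \<Rightarrow> 'b set \<Rightarrow> ('a \<times> 'b) set \<Rightarrow> ('a option \<times> 'b option) set" where
  "star_rel A\<^sub>1 A\<^sub>2 Q =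
    map_prod Some Some ` Q \<union> (Some ` A\<^sub>1) \<times> {None} \<union> {None} \<times> (Some ` A\<^sub>2)"

text \<open>
  \<open>map_spmf Some \<mu>\<^sub>i\<close> is \<open>\<mu>\<^sub>i\<close> extended to the starred set by \<open>\<mu>\<^sub>i(\<star>) = 0\<close>.
\<close>

definition has_approx_lifting ::
  "'a set \<Rightarrow> 'b set \<Rightarrow> real \<Rightarrow> real \<Rightarrow> ('a \<times> 'b) set \<Rightarrow> 'a spmf \<Rightarrow> 'b spmf \<Rightarrow> bool" where
  "has_approx_lifting A\<^sub>1 A\<^sub>2 \<epsilon> \<delta> Q \<mu>\<^sub>1 \<mu>\<^sub>2 \<longleftrightarrow>
    (\<exists>\<mu>L \<mu>R :: ('a option \<times> 'b option) spmf.
       subdist_on (star A\<^sub>1 \<times> star A\<^sub>2) \<mu>L \<and>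
       subdist_on (star A\<^sub>1 \<times> star A\<^sub>2) \<mu>R \<and>
       map_spmf fst \<mu>L = map_spmf Some \<mu>\<^sub>1 \<and>
       map_spmf snd \<mu>R = map_spmf Some \<mu>\<^sub>2 \<and>
       set_spmf \<mu>L \<union> set_spmf \<mu>R \<subseteq> star_rel A\<^sub>1 A\<^sub>2 Q \<and>
       eps_dist \<epsilon> \<mu>L \<mu>R \<le> \<delta>)"

end

theory Submission
  imports Defs
begin

text \<open>
  Glue the left witnesses along the first coordinate: use the one for \<open>R\<close> where
  \<open>a\<^sub>1 \<in> P\<close> and the one for \<open>S\<close> elsewhere. Glue the right witnesses along the second
  coordinate: use the one for \<open>R\<close> where \<open>a\<^sub>2 \<in> R(P)\<close> and the one for \<open>S\<close> elsewhere.
  Gluing along a coordinate on which the marginals agree preserves that marginal. In the right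
  witness, pairs whose two coordinates disagree about the side they belong to are then moved to
  \<open>(\<star>, a\<^sub>2)\<close>. As \<open>R(P)\<close> and \<open>S(A\<^sub>1 \<setminus> P)\<close> are disjoint, this never removes mass from the
  pairs in \<open>P \<times> A\<^sub>2\<close> charged by the right witness for \<open>R\<close>, nor from those in
  \<open>(A\<^sub>1 \<setminus> P) \<times> A\<^sub>2\<close> charged by the one for \<open>S\<close>, so that each side contributes at most \<open>\<delta>\<close>.
\<close>

lemma eps_dist_upper:
  "measure (measure_spmf p) X - exp \<epsilon> * measure (measure_spmf q) X \<le> eps_dist \<epsilon> p q"
  by (metis eps_dist_attained)

lemma eps_dist_leI:
  assumes "\<And>X. measure (measure_spmf p) X - exp \<epsilon> * measure (measure_spmf q) X \<le> d"
  shows "eps_dist \<epsilon> p q \<le> d"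
  using assms by (metis eps_dist_attained)

lemma measure_spmf_mono_on_support:
  assumes "X \<inter> set_spmf p \<subseteq> Y"
  shows "measure (measure_spmf p) X \<le> measure (measure_spmf p) Y"
proof (rule has_sum_mono_neutral[OF has_sum_measure_spmf has_sum_measure_spmf])
  show "spmf p x \<le> 0" if "x \<in> X - Y" for x
    using that assms by (auto simp: spmf_eq_0_set_spmf)
qed auto

text \<open>The glued mass is \<open>p\<close> on the preimage of \<open>C\<close> under
  \<open>f\<close> and \<open>q\<close> off it. Each fibre of \<open>f\<close> lies wholly on one
  side, so its mass comes from \<open>p\<close> alone or from \<open>q\<close> alone, and these
  agree by \<open>marg\<close>.\<close>

lemma glue_spmf_exists:
  assumes marg: "map_spmf f p = map_spmf f q"
  obtains r where
    "\<And>X. measure (measure_spmf r) X =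
      measure (measure_spmf p) (X \<inter> f -` C) + measure (measure_spmf q) (X - f -` C)"
    "set_spmf r = set_spmf p \<inter> f -` C \<union> (set_spmf q - f -` C)"
    "map_spmf f r = map_spmf f p"
proof -
  let ?D = "f -` C"
  define h where "h x = (if f x \<in> C then spmf p x else spmf q x)" for x
  have sum: "(h has_sum measure (measure_spmf p) (X \<inter> ?D) + measure (measure_spmf q) (X - ?D)) X"
    for X
  proof -
    have "(h has_sum measure (measure_spmf p) (X \<inter> ?D)) (X \<inter> ?D)"
      by (rule has_sum_cong[THEN iffD1, OF _ has_sum_measure_spmf]) (auto simp: h_def)
    moreover have "(h has_sum measure (measure_spmf q) (X - ?D)) (X - ?D)"
      by (rule has_sum_cong[THEN iffD1, OF _ has_sum_measure_spmf]) (auto simp: h_def)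
    ultimately show ?thesis
      using has_sum_Un_disjoint[of h "X \<inter> ?D" _ "X - ?D"]
      by (auto simp: Int_Diff_Un Int_Diff_disjoint)
  qed
  \<comment> \<open>Trading \<open>q\<close> for \<open>p\<close> on \<open>?D\<close> keeps the
    total mass of \<open>q\<close>, so the glued function has total mass at most 1.\<close>
  have "measure (measure_spmf p) ?D = measure (measure_spmf q) ?D"
    using marg by (metis measure_map_spmf)
  then have "measure (measure_spmf p) (UNIV \<inter> ?D) + measure (measure_spmf q) (UNIV - ?D)
      = measure (measure_spmf q) UNIV"
    using measure_spmf.finite_measure_Union[of ?D q "- ?D"] by (simp add: Compl_eq_Diff_UNIV)
  then have "infsum h UNIV \<le> 1"
    using infsumI[OF sum[of UNIV]] measure_spmf.subprob_measure_le_1[of q UNIV] by simp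
  moreover have "h summable_on UNIV"
    using sum[of UNIV] by (auto simp: summable_on_def)
  moreover have "0 \<le> h x" for x
    by (simp add: h_def)
  ultimately obtain r where r: "\<And>x. spmf r x = h x"
    using subdist_on_exists[of UNIV h] by auto
  have meas: "measure (measure_spmf r) X =
      measure (measure_spmf p) (X \<inter> ?D) + measure (measure_spmf q) (X - ?D)" for X
    using has_sum_unique[OF has_sum_measure_spmf[of r X]] sum[of X] by (simp add: r)
  have "set_spmf r = set_spmf p \<inter> ?D \<union> (set_spmf q - ?D)"
    by (auto simp: in_set_spmf_iff_spmf r h_def split: if_splits)
  moreover have "map_spmf f r = map_spmf f p"
  proof (rule spmf_eqI)
    fix y
    have "f -` {y} \<inter> ?D = (if y \<in> C then f -` {y} else {})"
      "f -` {y} - ?D = (if y \<in> C then {} else f -` {y})"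
      by auto
    then have "spmf (map_spmf f r) y = (if y \<in> C then spmf (map_spmf f p) y else spmf (map_spmf f q) y)"
      by (simp add: spmf_map meas)
    then show "spmf (map_spmf f r) y = spmf (map_spmf f p) y"
      by (simp add: marg)
  qed
  ultimately show ?thesis
    using that meas by blast
qed

theorem theorem4p34:
  fixes A\<^sub>1 :: "'a set" and A\<^sub>2 :: "'b set"
    and \<mu>\<^sub>1 :: "'a spmf" and \<mu>\<^sub>2 :: "'b spmf"
    and \<epsilon> \<delta> :: real
    and P :: "'a set" and R S :: "('a \<times> 'b) set"
  assumes "countable A\<^sub>1" and "countable A\<^sub>2"
    and "subdist_on A\<^sub>1 \<mu>\<^sub>1" and "subdist_on A\<^sub>2 \<mu>\<^sub>2"
    and "P \<subseteq> A\<^sub>1"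
    and "R \<subseteq> A\<^sub>1 \<times> A\<^sub>2" and "S \<subseteq> A\<^sub>1 \<times> A\<^sub>2"
    and "has_approx_lifting A\<^sub>1 A\<^sub>2 \<epsilon> \<delta> R \<mu>\<^sub>1 \<mu>\<^sub>2"
    and "has_approx_lifting A\<^sub>1 A\<^sub>2 \<epsilon> \<delta> S \<mu>\<^sub>1 \<mu>\<^sub>2"
    and "(R `` P) \<inter> (S `` (A\<^sub>1 - P)) = {}"
  shows "has_approx_lifting A\<^sub>1 A\<^sub>2 \<epsilon> (2 * \<delta>)
           {(a\<^sub>1, a\<^sub>2) \<in> A\<^sub>1 \<times> A\<^sub>2.
              (a\<^sub>1 \<in> P \<longrightarrow> (a\<^sub>1, a\<^sub>2) \<in> R) \<and> (a\<^sub>1 \<notin> P \<longrightarrow> (a\<^sub>1, a\<^sub>2) \<in> S)}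
           \<mu>\<^sub>1 \<mu>\<^sub>2"
proof -
  obtain LR RR where
    LR1: "map_spmf fst LR = map_spmf Some \<mu>\<^sub>1" and RR2: "map_spmf snd RR = map_spmf Some \<mu>\<^sub>2"
    and LR_supp: "set_spmf LR \<subseteq> star_rel A\<^sub>1 A\<^sub>2 R" and RR_supp: "set_spmf RR \<subseteq> star_rel A\<^sub>1 A\<^sub>2 R"
    and R_dist: "eps_dist \<epsilon> LR RR \<le> \<delta>"
    using assms(8) by (auto simp: has_approx_lifting_def)
  obtain LS RS where
    LS1: "map_spmf fst LS = map_spmf Some \<mu>\<^sub>1" and RS2: "map_spmf snd RS = map_spmf Some \<mu>\<^sub>2"
    and LS_supp: "set_spmf LS \<subseteq> star_rel A\<^sub>1 A\<^sub>2 S" and RS_supp: "set_spmf RS \<subseteq> star_rel A\<^sub>1 A\<^sub>2 S"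
    and S_dist: "eps_dist \<epsilon> LS RS \<le> \<delta>"
    using assms(9) by (auto simp: has_approx_lifting_def)
  let ?T = "{(a\<^sub>1, a\<^sub>2) \<in> A\<^sub>1 \<times> A\<^sub>2.
    (a\<^sub>1 \<in> P \<longrightarrow> (a\<^sub>1, a\<^sub>2) \<in> R) \<and> (a\<^sub>1 \<notin> P \<longrightarrow> (a\<^sub>1, a\<^sub>2) \<in> S)}"
  \<comment> \<open>As \<open>None\<close> is not in \<open>P'\<close>, a star in the first
    coordinate counts as the \<open>S\<close> side. The map \<open>g\<close> never touches the
    second coordinate, so it preserves the right marginal.\<close>
  define P' B where "P' = Some ` P" and "B = Some ` (R `` P)"
  define g where "g = (\<lambda>(a, b). (if a \<in> P' \<longleftrightarrow> b \<in> B then a else None, b))"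
  have fst_Some: "fst ` set_spmf LR \<subseteq> range Some" "fst ` set_spmf LS \<subseteq> range Some"
    using arg_cong[OF LR1, of set_spmf] arg_cong[OF LS1, of set_spmf] by auto
  have snd_Some: "snd ` set_spmf RR \<subseteq> Some ` A\<^sub>2" "snd ` set_spmf RS \<subseteq> Some ` A\<^sub>2"
    using arg_cong[OF RR2, of set_spmf] arg_cong[OF RS2, of set_spmf] assms(4)
    by (auto simp: subdist_on_def)
  obtain L where
    L: "\<And>X. measure (measure_spmf L) X =
      measure (measure_spmf LR) (X \<inter> fst -` P') + measure (measure_spmf LS) (X - fst -` P')"
    and L_set: "set_spmf L = set_spmf LR \<inter> fst -` P' \<union> (set_spmf LS - fst -` P')"
    and L_map: "map_spmf fst L = map_spmf fst LR"
    using glue_spmf_exists[of fst LR LS P'] LR1 LS1 by auto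
  obtain G where
    G: "\<And>X. measure (measure_spmf G) X =
      measure (measure_spmf RR) (X \<inter> snd -` B) + measure (measure_spmf RS) (X - snd -` B)"
    and G_set: "set_spmf G = set_spmf RR \<inter> snd -` B \<union> (set_spmf RS - snd -` B)"
    and G_map: "map_spmf snd G = map_spmf snd RR"
    using glue_spmf_exists[of snd RR RS B] RR2 RS2 by auto
  have g_snd: "snd \<circ> g = snd"
    by (auto simp: g_def)
  have L_supp: "set_spmf L \<subseteq> star_rel A\<^sub>1 A\<^sub>2 ?T"
  proof
    fix x assume "x \<in> set_spmf L"
    then consider "x \<in> set_spmf LR" "fst x \<in> P'" | "x \<in> set_spmf LS" "fst x \<notin> P'"
      using L_set by auto
    then show "x \<in> star_rel A\<^sub>1 A\<^sub>2 ?T"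
    proof cases
      case 1
      then show ?thesis
        using subsetD[OF LR_supp] assms(6) by (fastforce simp: star_rel_def P'_def)
    next
      case 2
      then show ?thesis
        using subsetD[OF LS_supp] assms(7) by (fastforce simp: star_rel_def P'_def)
    qed
  qed
  have G_supp: "set_spmf (map_spmf g G) \<subseteq> star_rel A\<^sub>1 A\<^sub>2 ?T"
  proof
    fix x assume "x \<in> set_spmf (map_spmf g G)"
    then obtain a b where x: "x = g (a, b)" and ab: "(a, b) \<in> set_spmf G"
      by auto
    have "snd (a, b) \<in> Some ` A\<^sub>2"
      using ab snd_Some unfolding G_set by blast
    then obtain b' where b: "b = Some b'" "b' \<in> A\<^sub>2"
      by auto
    \<comment> \<open>Whether \<open>b\<close> is in \<open>B\<close> tells which right witness
      charges the pair. If \<open>a\<close> is on the same side, that witness supplies the relation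
      which \<open>?T\<close> demands; otherwise the star absorbs the pair.\<close>
    show "x \<in> star_rel A\<^sub>1 A\<^sub>2 ?T"
    proof (cases "(a \<in> P' \<longleftrightarrow> b \<in> B) \<and> a \<noteq> None")
      case False
      then have "x = (None, b)"
        by (auto simp: x g_def)
      then show ?thesis
        using b by (auto simp: star_rel_def)
    next
      case True
      then obtain a' where a: "a = Some a'"
        by auto
      have "(a', b') \<in> ?T"
      proof (cases "b \<in> B")
        case B: True
        then have "(a', b') \<in> R"
          using ab RR_supp a b unfolding G_set by (auto simp: star_rel_def)
        then show ?thesis
          using True B a assms(6) by (auto simp: P'_def)
      next
        case B: False
        then have "(a', b') \<in> S"
          using ab RS_supp a b unfolding G_set by (auto simp: star_rel_def)
        then show ?thesis
          using True B a assms(7) by (auto simp: P'_def)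
      qed
      then show ?thesis
        using True a b by (force simp: x g_def star_rel_def)
    qed
  qed
  have "eps_dist \<epsilon> L (map_spmf g G) \<le> 2 * \<delta>"
  proof (rule eps_dist_leI)
    fix X :: "('a option \<times> 'b option) set"
    \<comment> \<open>First coordinate \<open>None\<close> is left out of \<open>?X\<^sub>S\<close>:
      \<open>RS\<close> may charge \<open>(None, b)\<close> with \<open>b\<close> in
      \<open>B\<close>, and gluing discards that mass. \<open>LS\<close> loses nothing, since it
      never charges such pairs.\<close>
    let ?X\<^sub>R = "X \<inter> fst -` P'" and ?X\<^sub>S = "X \<inter> fst -` (Some ` (- P))"
    have "?X\<^sub>R \<inter> set_spmf RR \<subseteq> g -` X \<inter> snd -` B"
    proof
      fix x assume x: "x \<in> ?X\<^sub>R \<inter> set_spmf RR"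
      then obtain a b where ab: "x = (Some a, Some b)" "a \<in> P"
        using snd_Some by (cases x) (fastforce simp: P'_def)
      then have "(a, b) \<in> R"
        using x RR_supp by (auto simp: star_rel_def)
      then show "x \<in> g -` X \<inter> snd -` B"
        using x ab by (auto simp: g_def P'_def B_def)
    qed
    note R_le = measure_spmf_mono_on_support[OF this]
    have "?X\<^sub>S \<inter> set_spmf RS \<subseteq> g -` X - snd -` B"
    proof
      fix x assume x: "x \<in> ?X\<^sub>S \<inter> set_spmf RS"
      then obtain a b where ab: "x = (Some a, Some b)" "a \<notin> P"
        using snd_Some by (cases x) fastforce
      then have "(a, b) \<in> S"
        using x RS_supp by (auto simp: star_rel_def)
      \<comment> \<open>Disjointness enters here: \<open>b\<close> is in the image under
        \<open>S\<close> of a point outside \<open>P\<close>. Hence gluing keeps the pair and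
        \<open>g\<close> fixes it.\<close>
      then have "b \<notin> R `` P"
        using ab assms(7,10) by blast
      then show "x \<in> g -` X - snd -` B"
        using x ab by (auto simp: g_def P'_def B_def)
    qed
    note S_le = measure_spmf_mono_on_support[OF this]
    have "(X - fst -` P') \<inter> set_spmf LS \<subseteq> ?X\<^sub>S"
    proof
      fix x assume x: "x \<in> (X - fst -` P') \<inter> set_spmf LS"
      then obtain a where "fst x = Some a"
        using fst_Some(2) by blast
      then show "x \<in> ?X\<^sub>S"
        using x by (auto simp: P'_def)
    qed
    note LS_le = measure_spmf_mono_on_support[OF this]
    \<comment> \<open>The new right witness dominates both old ones on their own events, so the two
      distance bounds, taken at \<open>?X\<^sub>R\<close> and \<open>?X\<^sub>S\<close>, add
      up.\<close>
    have "exp \<epsilon> * (measure (measure_spmf RR) ?X\<^sub>R + measure (measure_spmf RS) ?X\<^sub>S)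
        \<le> exp \<epsilon> * measure (measure_spmf (map_spmf g G)) X"
      using R_le S_le by (simp add: measure_map_spmf G)
    then show "measure (measure_spmf L) X - exp \<epsilon> * measure (measure_spmf (map_spmf g G)) X
        \<le> 2 * \<delta>"
      using eps_dist_upper[of LR ?X\<^sub>R \<epsilon> RR] eps_dist_upper[of LS ?X\<^sub>S \<epsilon> RS] R_dist S_dist LS_le
      unfolding L by (simp add: distrib_left)
  qed
  moreover have "star_rel A\<^sub>1 A\<^sub>2 ?T \<subseteq> star A\<^sub>1 \<times> star A\<^sub>2"
    by (auto simp: star_rel_def star_def)
  moreover have "map_spmf snd (map_spmf g G) = map_spmf Some \<mu>\<^sub>2"
    using G_map RR2 by (simp add: spmf.map_comp g_snd)
  ultimately show ?thesis
    unfolding has_approx_lifting_def subdist_on_def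
    using L_supp G_supp L_map LR1 by (intro exI[of _ L] exI[of _ "map_spmf g G"]) auto
qed

end
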